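(* Let $A\in\mathbb{R}^{n\times n}$, $n\ge 2$, be a Type-III bdsw matrix. Then the following are equivalent: (i) $A\in\mathbf{Q}$. (ii) $(-1)^{n+1}\det A>0$. (iii) $A\in\mathbf{R}_0$ and $\deg A=\pm 1$.
   Context: A matrix $A\in\mathbb{R}^{n\times n}$, $n\ge 2$, is a bidiagonal southwest (bdsw) matrix if its $(i,j)$ entry is zero unless $j=i$, or $j=i+1$, or $(i,j)=(n,1)$. In row $i<n$ the relevant off-diagonal entry is the $(i,i+1)$ entry; in row $n$ it is the $(n,1)$ entry. A Type-III bdsw matrix is a bdsw matrix in which, in each row, the diagonal entry is negative and the relevant off-diagonal entry is positive. For $A\in\mathbb{R}^{n\times n}$ and $q\in\mathbb{R}^n$, $\mathrm{LCP}(A,q)$ is the problem of finding $x\in\mathbb{R}^n$ with $x\ge 0$, $Ax+q\ge 0$ and $x^\top(Ax+q)=0$ (componentwise inequalities). $A\in\mathbf{Q}$ if $\mathrm{LCP}(A,q)$ has a solution for every $q\in\mathbb{R}^n$. $A\in\mathbf{R}_0$ if $x=0$ is the only solution of $\mathrm{LCP}(A,0)$. For $A\in\mathbf{R}_0$, let $f(x):=\min\{x,Ax\}$ (componentwise minimum) on $\mathbb{R}^n$; then $f(x)=0$ only for $x=0$, and $\deg A:=\deg(f,\Omega,0)$ is the topological (Brouwer) degree of $f$ at $0$ relative to any bounded open set $\Omega\subset\mathbb{R}^n$ containing $0$. *)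

theory Defs
  imports "HOL-Analysis.Analysis" "HOL-Homology.Homology"
begin

section \<open>Bidiagonal southwest matrices\<close>

text \<open>Rows and columns are indexed by an arbitrary finite linearly ordered type \<open>'n\<close>, with
  \<open>n = CARD('n)\<close>; \<open>idx\<close> is the order isomorphism from \<open>'n\<close> onto \<open>{1..n}\<close>.\<close>

definition idx :: "'n::{finite,linorder} \<Rightarrow> nat" where
  "idx i = card {..i}"

definition relevant_offdiag :: "'n::{finite,linorder} \<Rightarrow> 'n \<Rightarrow> bool" where
  "relevant_offdiag i j \<longleftrightarrow> idx j = idx i + 1 \<or> (idx i = CARD('n) \<and> idx j = 1)"

definition bdsw :: "real^('n::{finite,linorder})^('n::{finite,linorder}) \<Rightarrow> bool" where
  "bdsw A \<longleftrightarrow> (\<forall>i j. j \<noteq> i \<and> \<not> relevant_offdiag i j \<longrightarrow> A $ i $ j = 0)"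

definition bdsw_type_III :: "real^('n::{finite,linorder})^('n::{finite,linorder}) \<Rightarrow> bool" where
  "bdsw_type_III A \<longleftrightarrow> bdsw A \<and> (\<forall>i. A $ i $ i < 0) \<and>
     (\<forall>i j. relevant_offdiag i j \<longrightarrow> A $ i $ j > 0)"

section \<open>Linear complementarity problems\<close>

definition LCP :: "real^'n^'n \<Rightarrow> real^'n \<Rightarrow> (real^'n) set" where
  "LCP A q = {x. (\<forall>i. x $ i \<ge> 0) \<and> (\<forall>i. (A *v x + q) $ i \<ge> 0) \<and> x \<bullet> (A *v x + q) = 0}"

definition Q_matrix :: "real^'n^'n \<Rightarrow> bool" where
  "Q_matrix A \<longleftrightarrow> (\<forall>q. LCP A q \<noteq> {})"

definition R0_matrix :: "real^'n^'n \<Rightarrow> bool" where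
  "R0_matrix A \<longleftrightarrow> LCP A 0 = {0}"

definition min_map :: "real^'n^'n \<Rightarrow> real^'n \<Rightarrow> real^'n" where
  "min_map A x = (\<chi> i. min (x $ i) ((A *v x) $ i))"

section \<open>The topological (Brouwer) degree\<close>

text \<open>\<open>topological_degree f \<Omega> y\<close> is \<open>deg(f,\<Omega>,y)\<close>, meaningful when \<open>\<Omega>\<close> is open and bounded,
  \<open>f\<close> is continuous on the closure of \<open>\<Omega>\<close>, and \<open>y\<close> is not in the image of the frontier of
  \<open>\<Omega>\<close>. This is the standard homological definition (Dold, Lectures on Algebraic Topology).
  Let \<open>m\<close> be the dimension of the space \<open>E\<close>, let \<open>K = {x \<in> \<Omega>. f x = y}\<close>, which is then
  compact, and let \<open>B\<close> be a closed ball around \<open>0\<close> containing \<open>\<Omega>\<close> and \<open>y\<close>. Consider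
    \<open>H\<^sub>m(\<Omega>, \<Omega> - K) \<rightarrow> H\<^sub>m(E, E - K) \<leftarrow> H\<^sub>m(E, E - B) \<rightarrow> H\<^sub>m(E, E - {y})\<close>,
  all induced by inclusions. The first map is an excision isomorphism, the last one an
  isomorphism of infinite cyclic groups. The degree is the integer \<open>d\<close> such that, whenever
  \<open>a\<close> in \<open>H\<^sub>m(E, E - B)\<close> and \<open>b\<close> in \<open>H\<^sub>m(\<Omega>, \<Omega> - K)\<close> have the same image in
  \<open>H\<^sub>m(E, E - K)\<close>, the class \<open>f\<^sub>* b\<close> in \<open>H\<^sub>m(E, E - {y})\<close> is \<open>d\<close> times the image of \<open>a\<close>.
  Source and target are oriented by the same class \<open>a\<close>, so no choice of generator is
  involved. The library writes homology groups multiplicatively.\<close>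

definition topological_degree ::
    "('a::euclidean_space \<Rightarrow> 'a) \<Rightarrow> 'a set \<Rightarrow> 'a \<Rightarrow> int" where
  "topological_degree f \<Omega> y =
     (let m = int DIM('a);
          E = (euclidean :: 'a topology);
          K = {x \<in> \<Omega>. f x = y}
      in (THE d::int. \<forall>r. \<Omega> \<union> {y} \<subseteq> cball 0 r \<longrightarrow>
            (\<forall>a \<in> carrier (relative_homology_group m E (- cball 0 r)).
             \<forall>b \<in> carrier (relative_homology_group m (top_of_set \<Omega>) (\<Omega> - K)).
               hom_induced m (top_of_set \<Omega>) (\<Omega> - K) E (- K) id b =
               hom_induced m E (- cball 0 r) E (- K) id a \<longrightarrow>
               hom_induced m (top_of_set \<Omega>) (\<Omega> - K) E (- {y}) f b =
               hom_induced m E (- cball 0 r) E (- {y}) id a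
                 [^]\<^bsub>relative_homology_group m E (- {y})\<^esub> d)))"

text \<open>For an \<open>R\<^sub>0\<close>-matrix \<open>A\<close>, the common value of \<open>deg(min{x, Ax}, \<Omega>, 0)\<close> over all bounded
  open \<open>\<Omega>\<close> containing \<open>0\<close>.\<close>

definition LCP_degree :: "real^'n^'n \<Rightarrow> int" where
  "LCP_degree A = (THE d. \<forall>\<Omega>. open \<Omega> \<and> bounded \<Omega> \<and> 0 \<in> \<Omega> \<longrightarrow>
     topological_degree (min_map A) \<Omega> 0 = d)"

end

theory Submission
  imports Defs
begin

text \<open>Write \<open>a\<close> for the negated diagonal and \<open>b\<close> for the relevant off-diagonal entries. The only
  permutations contributing to the determinant are the identity and the full cycle, so condition
  (ii) says \<open>\<Prod>a < \<Prod>b\<close>, and \<open>A\<close> is an \<open>R\<^sub>0\<close>-matrix iff the two products differ.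

  If \<open>\<Prod>a < \<Prod>b\<close>, the inverse of \<open>A\<close> is positive. Let \<open>x = -A\<^sup>-\<^sup>1 q\<close>. If \<open>x\<close> is not nonnegative,
  adding a suitable positive multiple of the \<open>m\<close>-th column of the inverse solves the problem, where
  \<open>m\<close> minimises the ratio of \<open>x\<close> to a positive vector on which all rows of \<open>A\<close> but the last vanish.
  Conversely, a solution for \<open>q = -1\<close> is a positive vector with positive image, which forces
  \<open>\<Prod>a < \<Prod>b\<close>.

  For the degree: if \<open>\<Prod>a < \<Prod>b\<close>, then \<open>Ax \<ge> 0\<close> implies \<open>x \<ge> 0\<close>, so the segment from \<open>min(x, Ax)\<close> to
  \<open>Ax\<close> avoids \<open>0\<close> for \<open>x \<noteq> 0\<close>, and the linear automorphism \<open>A\<close> acts as \<open>\<plusminus>1\<close> on the infinite cyclic local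
  homology group. If \<open>\<Prod>b < \<Prod>a\<close>, the map omits every positive vector and therefore has degree 0.\<close>

section \<open>Local homology and the topological degree\<close>

lemma infinite_cyclic_generator:
  assumes "group G" "G \<cong> integer_group"
  obtains z where "z \<in> carrier G" "\<And>x. x \<in> carrier G \<Longrightarrow> \<exists>k::int. x = z [^]\<^bsub>G\<^esub> k"
    "\<And>k l::int. z [^]\<^bsub>G\<^esub> k = z [^]\<^bsub>G\<^esub> l \<Longrightarrow> k = l"
proof -
  interpret group G by fact
  obtain h where h: "h \<in> iso integer_group G"
    using assms iso_sym unfolding is_iso_def by blast
  then interpret h: group_hom integer_group G h
    by (simp add: group_hom_def group_hom_axioms_def iso_def)
  have pow: "h 1 [^]\<^bsub>G\<^esub> k = h k" for k :: int
    using h.hom_int_pow[of 1 k] by simp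
  have bij: "bij_betw h UNIV (carrier G)" using h by (simp add: iso_def)
  show thesis
  proof
    show "h 1 \<in> carrier G" using h.hom_closed by simp
    show "\<exists>k::int. x = h 1 [^]\<^bsub>G\<^esub> k" if "x \<in> carrier G" for x
      using bij that unfolding pow bij_betw_def by blast
    show "k = l" if "h 1 [^]\<^bsub>G\<^esub> k = h 1 [^]\<^bsub>G\<^esub> l" for k l :: int
      using bij that unfolding pow bij_betw_def by (meson UNIV_I inj_onD)
  qed
qed

text \<open>The exponent \<open>e\<close> of the image of a generator determines an endomorphism;
  surjectivity makes \<open>e\<close> a unit of the integers.\<close>

lemma infinite_cyclic_automorphism:
  assumes "group G" "G \<cong> integer_group" "h \<in> iso G G"
  obtains e :: int where "e = 1 \<or> e = -1" "\<And>x. x \<in> carrier G \<Longrightarrow> h x = x [^]\<^bsub>G\<^esub> e"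
proof -
  interpret group G by fact
  obtain z where z: "z \<in> carrier G"
    and gen: "\<And>x. x \<in> carrier G \<Longrightarrow> \<exists>k::int. x = z [^]\<^bsub>G\<^esub> k"
    and inj: "\<And>k l::int. z [^]\<^bsub>G\<^esub> k = z [^]\<^bsub>G\<^esub> l \<Longrightarrow> k = l"
    by (rule infinite_cyclic_generator[OF assms(1,2)]) blast
  interpret h: group_hom G G h
    using assms by (simp add: group_hom_def group_hom_axioms_def iso_def)
  obtain e :: int where e: "h z = z [^]\<^bsub>G\<^esub> e" using gen z h.hom_closed by blast
  have he: "h x = x [^]\<^bsub>G\<^esub> e" if x: "x \<in> carrier G" for x
  proof -
    obtain k :: int where k: "x = z [^]\<^bsub>G\<^esub> k" using gen[OF x] by blast
    have "h x = (h z) [^]\<^bsub>G\<^esub> k" unfolding k using h.hom_int_pow[OF z] .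
    then show ?thesis using z by (simp add: e k int_pow_pow mult.commute)
  qed
  have "z \<in> h ` carrier G" using assms(3) z by (simp add: iso_def bij_betw_def)
  then obtain y where y: "y \<in> carrier G" "h y = z" by (metis imageE)
  obtain k :: int where "y = z [^]\<^bsub>G\<^esub> k" using gen[OF y(1)] by blast
  then have "z [^]\<^bsub>G\<^esub> (k * e) = z [^]\<^bsub>G\<^esub> (1::int)"
    using he[OF y(1)] y z by (simp add: int_pow_pow)
  then have "k * e = 1" using inj by blast
  then have "e = 1 \<or> e = -1" by (metis pos_zmult_eq_1_iff_lemma mult.commute)
  then show thesis using that he by blast
qed

section \<open>Local homology of Euclidean space at the origin\<close>

text \<open>Contractibility of the whole space leads to the reduced homology of the punctured space
  one degree lower; that space is homotopy equivalent to the unit sphere.\<close>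

lemma relative_homology_group_punctured:
  "relative_homology_group (int DIM('a)) (euclidean :: 'a::euclidean_space topology) (- {0}) \<cong> integer_group"
proof -
  let ?E = "euclidean :: 'a topology"
  let ?S = "sphere 0 1 :: 'a set"
  have contr: "contractible_space ?E"
    using contractible_UNIV by (metis contractible_space_top_of_set subtopology_UNIV)
  have ne: "topspace ?E \<inter> - {0} \<noteq> {}"
    using UNIV_not_singleton[of "0 :: 'a"] by auto
  have 1: "relative_homology_group (int DIM('a)) ?E (- {0})
      \<cong> reduced_homology_group (int DIM('a) - 1) (top_of_set (- {0 :: 'a}))"
    by (rule isomorphic_group_relative_homology_of_contractible[OF contr ne])
  have "rel_frontier (cball (0 :: 'a) 1) homotopy_eqv (affine hull (cball 0 1) - {0 :: 'a})"
    by (rule homotopy_eqv_rel_frontier_punctured_affine_hull)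
      (auto simp: rel_interior_nonempty_interior)
  moreover have "affine hull (cball 0 1) = (UNIV :: 'a set)"
    by (simp add: affine_hull_nonempty_interior)
  ultimately have "top_of_set ?S homotopy_equivalent_space top_of_set (- {0 :: 'a})"
    by (simp add: rel_frontier_nonempty_interior Compl_eq_Diff_UNIV)
  then have 2: "reduced_homology_group (int DIM('a) - 1) (top_of_set (- {0 :: 'a}))
      \<cong> reduced_homology_group (int DIM('a) - 1) (top_of_set ?S)"
    using homotopy_equivalent_space_imp_isomorphic_reduced_homology_groups homotopy_equivalent_space_sym
    by blast
  obtain f :: "(nat \<Rightarrow> real) \<Rightarrow> 'a" and g
    where "homeomorphic_maps (nsphere (DIM('a) - 1)) (top_of_set (?S \<inter> span Basis)) f g"
    by (rule homeomorphic_maps_nsphere_euclidean_sphere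
      [OF independent_Basis orthogonal_Basis refl _ norm_Basis, where 'n='a]) auto
  then have "top_of_set ?S homeomorphic_space nsphere (DIM('a) - 1)"
    using homeomorphic_maps_imp_homeomorphic_space homeomorphic_space_sym by fastforce
  then have 3: "reduced_homology_group (int DIM('a) - 1) (top_of_set ?S)
      \<cong> reduced_homology_group (int DIM('a) - 1) (nsphere (DIM('a) - 1))"
    by (rule homeomorphic_space_imp_isomorphic_reduced_homology_groups)
  have "int DIM('a) - 1 = int (DIM('a) - 1)" using DIM_positive[where 'a='a] by linarith
  then have 4: "reduced_homology_group (int DIM('a) - 1) (nsphere (DIM('a) - 1)) \<cong> integer_group"
    by (simp only: reduced_homology_group_nsphere(1))
  show ?thesis by (rule iso_trans[OF 1 iso_trans[OF 2 iso_trans[OF 3 4]]])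
qed

text \<open>Both boundary maps are isomorphisms by contractibility, so by naturality it is enough
  that the complement of the ball includes into the punctured space as a homotopy
  equivalence.\<close>

lemma hom_induced_complement_cball_iso:
  fixes r :: real
  assumes "r \<ge> 0"
  shows "hom_induced p euclidean (- cball 0 r) euclidean (- {0}) id
    \<in> iso (relative_homology_group p (euclidean :: 'a::euclidean_space topology) (- cball 0 r))
        (relative_homology_group p (euclidean :: 'a topology) (- {0}))" (is "?i \<in> iso ?B ?P")
proof -
  let ?E = "euclidean :: 'a topology"
  let ?TB = "top_of_set (- cball 0 r :: 'a set)" and ?TP = "top_of_set (- {0} :: 'a set)"
  have contr: "contractible_space ?E"
    using contractible_UNIV by (metis contractible_space_top_of_set subtopology_UNIV)
  obtain u :: 'a where u: "norm u = r + 1" using vector_choose_size[of "r+1"] assms by auto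
  have uB: "u \<in> topspace ?E \<inter> - cball 0 r" and uP: "u \<in> topspace ?E \<inter> - {0}"
    using u assms by auto
  have dB: "hom_boundary p ?E (- cball 0 r) \<in> iso ?B (reduced_homology_group (p-1) ?TB)"
    using uB by (intro iso_relative_homology_of_contractible contr) blast
  have dP: "hom_boundary p ?E (- {0}) \<in> iso ?P (reduced_homology_group (p-1) ?TP)"
    using uP by (intro iso_relative_homology_of_contractible contr) blast
  \<comment> \<open>Homotopy inverse of the inclusion: a radial push that lengthens each vector by
    \<open>r + 1\<close> and so takes it out of the ball.\<close>
  let ?g = "\<lambda>x::'a. ((norm x + r + 1) / norm x) *\<^sub>R x"
  have ng: "norm (?g x) = norm x + r + 1" if "x \<noteq> 0" for x using that assms by simp
  have contg: "continuous_on (- {0}) ?g" by (intro continuous_intros) auto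
  \<comment> \<open>Points between \<open>x\<close> and \<open>?g x\<close> are multiples of
    \<open>x\<close> by factors at least 1, so the straight-line homotopy to the identity stays in
    either complement.\<close>
  have seg: "closed_segment (?g x) x \<subseteq> T"
    if x: "x \<noteq> 0" and T: "\<And>c. c \<ge> 1 \<Longrightarrow> c *\<^sub>R x \<in> T" for x T
  proof
    fix y assume "y \<in> closed_segment (?g x) x"
    then obtain t where t: "0 \<le> t" "t \<le> 1" and y: "y = (1 - t) *\<^sub>R ?g x + t *\<^sub>R x"
      by (auto simp: closed_segment_def)
    let ?c = "(1 - t) * ((norm x + r + 1) / norm x) + t"
    have "(norm x + r + 1) / norm x \<ge> 1" using x assms by (simp add: field_simps)
    then have "?c \<ge> (1 - t) * 1 + t" using t by (intro add_right_mono mult_left_mono) auto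
    then have "?c *\<^sub>R x \<in> T" using T by simp
    moreover have "y = ?c *\<^sub>R x" unfolding y by (simp add: scaleR_add_left)
    ultimately show "y \<in> T" by simp
  qed
  have iB: "hom_induced (p-1) ?TB {} ?TP {} id
      \<in> iso (reduced_homology_group (p-1) ?TB) (reduced_homology_group (p-1) ?TP)"
  proof (rule homotopy_equivalence_reduced_homology_group_isomorphism)
    show "continuous_map ?TB ?TP id" using assms by (auto)
    have "\<not> norm (?g x) \<le> r" if "x \<noteq> 0" for x using ng[OF that] norm_ge_zero[of x] by linarith
    then show "continuous_map ?TP ?TB ?g" using contg by (simp add: Pi_iff)
    have "homotopic_with_canon (\<lambda>h. True) (- cball 0 r) (- cball 0 r) ?g id"
    proof (rule homotopic_with_linear)
      show "continuous_on (- cball 0 r) ?g"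
        using contg by (rule continuous_on_subset) (use assms in auto)
      fix x :: 'a assume x: "x \<in> - cball 0 r"
      have "norm (c *\<^sub>R x) > r" if "c \<ge> 1" for c
        using mult_right_mono[OF that, of "norm x"] x that by auto
      moreover have "x \<noteq> 0" using x assms by auto
      ultimately have "closed_segment (?g x) x \<subseteq> - cball 0 r" by (intro seg) (simp_all add: not_le)
      then show "closed_segment (?g x) (id x) \<subseteq> - cball 0 r" by simp
    qed (auto intro: continuous_intros)
    then show "homotopic_with (\<lambda>h. True) ?TB ?TB (?g \<circ> id) id" by simp
    have "homotopic_with_canon (\<lambda>h. True) (- {0}) (- {0}) ?g id"
      by (rule homotopic_with_linear[OF contg]) (use seg[of _ "- {0}"] in \<open>force intro: continuous_intros\<close>)+
    then show "homotopic_with (\<lambda>h. True) ?TP ?TP (id \<circ> ?g) id" by simp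
  qed
  have nat: "hom_boundary p ?E (- {0}) \<circ> ?i
      = hom_induced (p-1) ?TB {} ?TP {} id \<circ> hom_boundary p ?E (- cball 0 r)"
    by (rule naturality_hom_induced) (use assms in auto)
  have "hom_boundary p ?E (- {0}) \<circ> ?i \<in> iso ?B (reduced_homology_group (p-1) ?TP)"
    unfolding nat using dB iB iso_set_trans by blast
  moreover have "?i \<in> hom ?B ?P" by (rule hom_induced_hom)
  moreover from this have "?i ` carrier ?B \<subseteq> carrier ?P" by (auto simp: hom_def)
  ultimately show ?thesis using dP bij_betw_comp_iff2 unfolding iso_def by blast
qed

text \<open>Excision of \<open>- \<Omega>\<close>, a closed set inside the open set
  \<open>- {c}\<close>.\<close>

lemma hom_induced_excision_point:
  assumes "open \<Omega>" "c \<in> \<Omega>"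
  shows "hom_induced p (top_of_set \<Omega>) (\<Omega> - {c}) euclidean (- {c}) id
    \<in> iso (relative_homology_group p (top_of_set \<Omega>) (\<Omega> - {c}))
        (relative_homology_group p (euclidean :: 'a::t1_space topology) (- {c}))"
proof -
  have "open (- {c})" by (rule open_Compl) simp
  then have "(euclidean closure_of (- \<Omega>)) \<subseteq> (euclidean interior_of (- {c}))"
    using assms by (auto simp: closed_Compl interior_open)
  moreover have "- {c} - - \<Omega> = \<Omega> - {c}" "UNIV - - \<Omega> = \<Omega>" by auto
  ultimately show ?thesis using homology_excision_axiom[of euclidean "- \<Omega>" "- {c}" UNIV p] by simp
qed

section \<open>Computing the degree of a map whose only zero is the origin\<close>

text \<open>Since \<open>K\<close> is \<open>{0}\<close>, the groups at \<open>K\<close> and at the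
  value \<open>0\<close> coincide, and the assumption on \<open>f\<close> is the defining property
  of \<open>d\<close>. Uniqueness comes from a generator \<open>z\<close>, lifted along the two
  preceding isomorphisms.\<close>

lemma topological_degree_eqI:
  fixes f :: "'a::euclidean_space \<Rightarrow> 'a"
  assumes \<Omega>: "open \<Omega>" "bounded \<Omega>" "0 \<in> \<Omega>" and K: "{x \<in> \<Omega>. f x = 0} = {0}"
    and f: "\<And>b. b \<in> carrier (relative_homology_group (int DIM('a)) (top_of_set \<Omega>) (\<Omega> - {0})) \<Longrightarrow>
      hom_induced (int DIM('a)) (top_of_set \<Omega>) (\<Omega> - {0}) euclidean (- {0}) f b
      = hom_induced (int DIM('a)) (top_of_set \<Omega>) (\<Omega> - {0}) euclidean (- {0}) id b
          [^]\<^bsub>relative_homology_group (int DIM('a)) (euclidean :: 'a topology) (- {0})\<^esub> d"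
  shows "topological_degree f \<Omega> 0 = d"
proof -
  let ?m = "int DIM('a)"
  let ?E = "euclidean :: 'a topology"
  let ?P = "relative_homology_group ?m ?E (- {0})"
  obtain r where r: "r \<ge> 0" "\<Omega> \<union> {0} \<subseteq> cball 0 r"
  proof -
    obtain r where "\<Omega> \<subseteq> cball 0 r" using \<Omega>(2) unfolding bounded_any_center[of _ 0] by (auto simp: subset_iff)
    then show thesis using that[of r] \<Omega>(3) by force
  qed
  obtain z where z: "z \<in> carrier ?P"
    and inj: "\<And>k l::int. z [^]\<^bsub>?P\<^esub> k = z [^]\<^bsub>?P\<^esub> l \<Longrightarrow> k = l"
    by (rule infinite_cyclic_generator[OF group_relative_homology_group relative_homology_group_punctured]) blast
  have "z \<in> hom_induced ?m ?E (- cball 0 r) ?E (- {0}) id `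
      carrier (relative_homology_group ?m ?E (- cball 0 r))"
    using hom_induced_complement_cball_iso[OF r(1), of ?m, where 'a='a] z
    by (simp add: iso_def bij_betw_def)
  then obtain a where a: "z = hom_induced ?m ?E (- cball 0 r) ?E (- {0}) id a"
      "a \<in> carrier (relative_homology_group ?m ?E (- cball 0 r))"
    by (rule imageE)
  have "z \<in> hom_induced ?m (top_of_set \<Omega>) (\<Omega> - {0}) ?E (- {0}) id `
      carrier (relative_homology_group ?m (top_of_set \<Omega>) (\<Omega> - {0}))"
    using hom_induced_excision_point[OF \<Omega>(1,3), of ?m] z
    by (simp add: iso_def bij_betw_def)
  then obtain b where b: "z = hom_induced ?m (top_of_set \<Omega>) (\<Omega> - {0}) ?E (- {0}) id b"
      "b \<in> carrier (relative_homology_group ?m (top_of_set \<Omega>) (\<Omega> - {0}))"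
    by (rule imageE)
  show ?thesis
    unfolding topological_degree_def Let_def K
  proof (rule the_equality, intro allI impI ballI)
    fix d' :: int
    assume "\<forall>r. \<Omega> \<union> {0} \<subseteq> cball 0 r \<longrightarrow>
            (\<forall>a\<in>carrier (relative_homology_group ?m ?E (- cball 0 r)).
             \<forall>b\<in>carrier (relative_homology_group ?m (top_of_set \<Omega>) (\<Omega> - {0})).
               hom_induced ?m (top_of_set \<Omega>) (\<Omega> - {0}) ?E (- {0}) id b =
               hom_induced ?m ?E (- cball 0 r) ?E (- {0}) id a \<longrightarrow>
               hom_induced ?m (top_of_set \<Omega>) (\<Omega> - {0}) ?E (- {0}) f b =
               hom_induced ?m ?E (- cball 0 r) ?E (- {0}) id a [^]\<^bsub>?P\<^esub> d')"
    from this[rule_format, OF r(2) a(2) b(2)]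
    have "hom_induced ?m (top_of_set \<Omega>) (\<Omega> - {0}) ?E (- {0}) f b = z [^]\<^bsub>?P\<^esub> d'"
      by (simp only: a(1)[symmetric] b(1)[symmetric])
    then show "d' = d" by (intro inj) (simp only: f[OF b(2)] b(1)[symmetric])
  qed (simp add: f)
qed

lemma hom_induced_eq_linear_homotopy:
  fixes f g :: "'a::real_normed_vector \<Rightarrow> 'b::real_normed_vector"
  assumes "continuous_on S f" "continuous_on S g" "U \<subseteq> S"
    and "\<And>x t. x \<in> U \<Longrightarrow> 0 \<le> t \<Longrightarrow> t \<le> 1 \<Longrightarrow> (1 - t) *\<^sub>R f x + t *\<^sub>R g x \<in> T"
  shows "hom_induced p (top_of_set S) U euclidean T f = hom_induced p (top_of_set S) U euclidean T g"
proof (rule homology_homotopy_axiom)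
  let ?h = "\<lambda>y. (1 - fst y) *\<^sub>R f (snd y) + fst y *\<^sub>R g (snd y)"
  have "continuous_on ({0..1} \<times> S) ?h"
    using assms(1,2)
    by (auto intro!: continuous_intros continuous_on_compose2[where s = "{0..1} \<times> S" and f = snd])
  then have "continuous_map (prod_topology (top_of_set {0..1}) (top_of_set S)) euclidean ?h"
    by (simp add: prod_topology_subtopology euclidean_product_topology subtopology_subtopology
        Times_Int_Times)
  then show "homotopic_with (\<lambda>h. h \<in> U \<rightarrow> T) (top_of_set S) euclidean f g"
    using assms(3,4) by (subst homotopic_with) (auto intro!: exI[of _ ?h] simp: Pi_iff subset_iff)
qed

text \<open>The segments from \<open>f\<close> to \<open>L\<close> avoid zero, so \<open>L\<close>
  may replace \<open>f\<close>. The exponent \<open>e\<close> belongs to the action of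
  \<open>L\<close> on the whole space and hence is the same for every
  \<open>\<Omega>\<close>.\<close>

lemma topological_degree_homotopic_linear_iso:
  fixes f L :: "'a::euclidean_space \<Rightarrow> 'a"
  assumes \<Omega>: "open \<Omega>" "bounded \<Omega>" "0 \<in> \<Omega>" and f: "continuous_on \<Omega> f" "f 0 = 0"
    and L: "linear L"
    and nz: "\<And>x t. x \<noteq> 0 \<Longrightarrow> 0 \<le> t \<Longrightarrow> t \<le> 1 \<Longrightarrow> (1 - t) *\<^sub>R f x + t *\<^sub>R L x \<noteq> 0"
    and e: "\<And>x. x \<in> carrier (relative_homology_group (int DIM('a)) (euclidean :: 'a topology) (- {0})) \<Longrightarrow>
      hom_induced (int DIM('a)) euclidean (- {0}) euclidean (- {0}) L x
      = x [^]\<^bsub>relative_homology_group (int DIM('a)) (euclidean :: 'a topology) (- {0})\<^esub> e"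
  shows "topological_degree f \<Omega> 0 = e"
proof (rule topological_degree_eqI[OF \<Omega>])
  show "{x \<in> \<Omega>. f x = 0} = {0}" using nz[of _ 0] f \<Omega> by auto
  fix b assume b: "b \<in> carrier (relative_homology_group (int DIM('a)) (top_of_set \<Omega>) (\<Omega> - {0}))"
  let ?h = "hom_induced (int DIM('a)) (top_of_set \<Omega>) (\<Omega> - {0}) (euclidean :: 'a topology) (- {0})"
  have cL: "continuous_on S L" for S using L by (simp add: linear_continuous_on linear_linear)
  have L0: "L x \<noteq> 0" if "x \<noteq> 0" for x using nz[OF that, of 1] by simp
  have "?h f = ?h L"
    by (rule hom_induced_eq_linear_homotopy) (use f cL nz in auto)
  moreover have "hom_induced (int DIM('a)) euclidean (- {0}) euclidean (- {0}) L (?h id b)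
      = ?h (L \<circ> id) b"
    by (rule hom_induced_compose') (use cL[of UNIV] L0 in \<open>auto simp: continuous_map_from_subtopology\<close>)
  moreover have "?h id b \<in> carrier (relative_homology_group (int DIM('a)) (euclidean :: 'a topology) (- {0}))"
    by (rule hom_in_carrier[OF hom_induced_hom b])
  ultimately show "?h f b = ?h id b [^]\<^bsub>relative_homology_group (int DIM('a)) (euclidean :: 'a topology) (- {0})\<^esub> e"
    using e by simp
qed

text \<open>A linear automorphism is a homeomorphism preserving \<open>- {0}\<close>, so it induces
  an automorphism of an infinite cyclic group.\<close>

lemma hom_induced_linear_iso_power:
  fixes L :: "'a::euclidean_space \<Rightarrow> 'a"
  assumes "linear L" "inj L"
  obtains e :: int where "e = 1 \<or> e = -1"
    "\<And>x. x \<in> carrier (relative_homology_group (int DIM('a)) (euclidean :: 'a topology) (- {0})) \<Longrightarrow>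
      hom_induced (int DIM('a)) euclidean (- {0}) euclidean (- {0}) L x
      = x [^]\<^bsub>relative_homology_group (int DIM('a)) (euclidean :: 'a topology) (- {0})\<^esub> e"
proof -
  let ?P = "relative_homology_group (int DIM('a)) (euclidean :: 'a topology) (- {0})"
  obtain g where "homeomorphism (range L) UNIV g L"
    by (rule linear_homeomorphism_image[OF assms])
  then have "homeomorphism UNIV UNIV L g"
    using homeomorphism_symD linear_injective_imp_surjective[OF assms] by metis
  then have "homeomorphic_map euclidean euclidean L"
    by (metis homeomorphic_map_maps homeomorphic_maps_iff_homeomorphism subtopology_UNIV)
  moreover have "L ` (- {0}) = - {0}"
    using linear_injective_imp_surjective[OF assms] assms
    by (metis bij_image_Compl_eq bij_betw_def image_insert image_empty linear_0)
  ultimately have "hom_induced (int DIM('a)) euclidean (- {0}) euclidean (- {0}) L \<in> iso ?P ?P"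
    by (intro homeomorphic_map_relative_homology_iso) auto
  then show thesis
    by (rule infinite_cyclic_automorphism[OF group_relative_homology_group relative_homology_group_punctured]) (rule that)
qed

text \<open>Moving from \<open>f\<close> to \<open>f - p\<close> creates no zeros off the origin,
  and \<open>f - p\<close> has none at all. Its induced map thus factors through the homology of the
  punctured space relative to itself, which is trivial.\<close>

lemma topological_degree_eq_0:
  fixes f :: "'a::euclidean_space \<Rightarrow> 'a"
  assumes \<Omega>: "open \<Omega>" "bounded \<Omega>" "0 \<in> \<Omega>" and f: "continuous_on \<Omega> f"
    and K: "\<And>x. f x = 0 \<longleftrightarrow> x = 0"
    and p: "\<And>x t. t > 0 \<Longrightarrow> f x \<noteq> t *\<^sub>R p"
  shows "topological_degree f \<Omega> 0 = 0"
proof (rule topological_degree_eqI[OF \<Omega>])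
  show "{x \<in> \<Omega>. f x = 0} = {0}" using K \<Omega> by auto
  fix b assume b: "b \<in> carrier (relative_homology_group (int DIM('a)) (top_of_set \<Omega>) (\<Omega> - {0}))"
  let ?g = "\<lambda>x. f x - p" and ?T = "top_of_set (- {0 :: 'a})"
  let ?h = "hom_induced (int DIM('a)) (top_of_set \<Omega>) (\<Omega> - {0}) (euclidean :: 'a topology) (- {0})"
  let ?P = "relative_homology_group (int DIM('a)) (euclidean :: 'a topology) (- {0})"
  let ?k = "hom_induced (int DIM('a)) (top_of_set \<Omega>) (\<Omega> - {0}) ?T (- {0}) ?g b"
  let ?i = "hom_induced (int DIM('a)) ?T (- {0}) (euclidean :: 'a topology) (- {0}) id"
  have g: "?g x \<noteq> 0" for x using p[of 1 x] by simp
  have "?h f = ?h ?g"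
  proof (rule hom_induced_eq_linear_homotopy)
    fix x and t :: real assume "x \<in> \<Omega> - {0}" "0 \<le> t" "t \<le> 1"
    moreover have "(1 - t) *\<^sub>R f x + t *\<^sub>R (f x - p) = f x - t *\<^sub>R p"
      by (simp add: algebra_simps)
    ultimately show "(1 - t) *\<^sub>R f x + t *\<^sub>R (f x - p) \<in> - {0}"
      using p[of t x] K by (cases "t = 0") auto
  qed (use f in \<open>auto intro: continuous_intros\<close>)
  moreover have "?i ?k = ?h (id \<circ> ?g) b"
    by (rule hom_induced_compose') (use f g in \<open>auto intro!: continuous_intros\<close>)
  moreover have "?k = \<one>\<^bsub>relative_homology_group (int DIM('a)) ?T (- {0})\<^esub>"
  proof -
    have "?k \<in> carrier (relative_homology_group (int DIM('a)) ?T (- {0}))"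
      by (rule hom_in_carrier[OF hom_induced_hom b])
    moreover have "trivial_group (relative_homology_group (int DIM('a)) ?T (- {0}))"
      using trivial_relative_homology_group_topspace[of _ ?T] by simp
    ultimately show ?thesis by (simp add: trivial_group_def)
  qed
  moreover have "?i \<one>\<^bsub>relative_homology_group (int DIM('a)) ?T (- {0})\<^esub> = \<one>\<^bsub>?P\<^esub>"
    by (intro hom_one hom_induced_hom) auto
  ultimately show "?h f b = ?h id b [^]\<^bsub>?P\<^esub> (0::int)" by (simp add: int_pow_0)
qed

section \<open>The cyclic successor\<close>

lemma strict_mono_idx: "strict_mono (idx :: 'n::{finite,linorder} \<Rightarrow> nat)"
proof (rule strict_monoI)
  fix i j :: 'n assume "i < j"
  then have "{..i} \<subset> {..j}" by auto
  then show "idx i < idx j" unfolding idx_def by (rule psubset_card_mono[OF finite])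
qed

lemma idx_less_iff [simp]: "idx i < idx j \<longleftrightarrow> i < j"
  and idx_le_iff [simp]: "idx i \<le> idx j \<longleftrightarrow> i \<le> j"
  and idx_eq_iff [simp]: "idx i = idx j \<longleftrightarrow> i = j"
  by (rule strict_mono_less[OF strict_mono_idx] strict_mono_less_eq[OF strict_mono_idx]
    strict_mono_eq[OF strict_mono_idx])+

lemma range_idx: "range (idx :: 'n::{finite,linorder} \<Rightarrow> nat) = {1..CARD('n)}"
proof (rule card_subset_eq)
  have "card {..i} > 0" "card {..i} \<le> CARD('n)" for i :: 'n
    by (auto simp: card_gt_0_iff intro: card_mono)
  then show "range (idx :: 'n \<Rightarrow> nat) \<subseteq> {1..CARD('n)}"
    by (auto simp: idx_def Suc_le_eq)
  show "card (range (idx :: 'n \<Rightarrow> nat)) = card {1..CARD('n)}"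
    by (simp add: card_image strict_mono_imp_inj_on strict_mono_idx)
qed simp

lemma idx_bounds:
  fixes i :: "'n::{finite,linorder}"
  shows "1 \<le> idx i" "idx i \<le> CARD('n)"
proof -
  have "idx i \<in> {1..CARD('n)}" unfolding range_idx[symmetric] by simp
  then show "1 \<le> idx i" "idx i \<le> CARD('n)" by simp_all
qed

definition cyc :: "'n::{finite,linorder} \<Rightarrow> 'n" where
  "cyc i = (THE j. relevant_offdiag i j)"

lemma relevant_offdiag_iff: "relevant_offdiag i j \<longleftrightarrow> j = cyc i"
proof -
  have "\<exists>!j. relevant_offdiag i j"
  proof (cases "idx i = CARD('a)")
    case True
    have "1 \<in> {1..CARD('a)}" by (simp add: Suc_le_eq)
    then obtain j :: 'a where j: "idx j = 1" unfolding range_idx[symmetric] by force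
    show ?thesis
    proof
      show "relevant_offdiag i j" using True j by (simp add: relevant_offdiag_def)
      fix k assume "relevant_offdiag i k"
      then have "idx k = idx j"
        using True j idx_bounds(2)[of k] by (simp add: relevant_offdiag_def)
      then show "k = j" by simp
    qed
  next
    case False
    then have "idx i + 1 \<in> {1..CARD('a)}" using idx_bounds(2)[of i] by simp
    then obtain j :: 'a where j: "idx j = idx i + 1" unfolding range_idx[symmetric] by force
    show ?thesis
    proof
      show "relevant_offdiag i j" using j by (simp add: relevant_offdiag_def)
      fix k assume "relevant_offdiag i k"
      then have "idx k = idx j" using False j by (simp add: relevant_offdiag_def)
      then show "k = j" by simp
    qed
  qed
  then have "relevant_offdiag i (cyc i)" unfolding cyc_def by (rule theI')
  then show ?thesis using \<open>\<exists>!j. relevant_offdiag i j\<close> by blast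
qed

lemma idx_cyc: "idx (cyc i) = (if idx i = CARD('n) then 1 else idx (i :: 'n::{finite,linorder}) + 1)"
  using relevant_offdiag_iff[of i "cyc i"] idx_bounds(2)[of "cyc i"]
  by (auto simp: relevant_offdiag_def)

lemma inj_cyc: "inj cyc"
proof (rule injI)
  fix i j :: 'a assume "cyc i = cyc j"
  then have eq: "idx (cyc i) = idx (cyc j)" by (rule arg_cong)
  \<comment> \<open>The lower bounds rule out the argument 0, which would collide with
    \<open>n\<close> at the value 1.\<close>
  have "x = y" if "(if x = n then 1 else x + 1) = (if y = n then 1 else y + 1)" "1 \<le> x" "1 \<le> y"
    for x y n :: nat
    using that by presburger
  from this[OF eq[unfolded idx_cyc] idx_bounds(1) idx_bounds(1)] show "i = j" by simp
qed

lemma bij_cyc: "bij cyc"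
  by (simp add: bij_def inj_cyc finite_UNIV_inj_surj[OF finite])

lemma prod_cyc: "(\<Prod>i\<in>UNIV. f (cyc i)) = (\<Prod>i\<in>UNIV. f i)"
  using bij_cyc by (rule prod.reindex_bij_betw)

lemma cyc_neq:
  assumes "CARD('n::{finite,linorder}) \<ge> 2" shows "cyc (i :: 'n) \<noteq> i"
proof
  assume "cyc i = i"
  then have "(if idx i = CARD('n) then 1 else idx i + 1) = idx i" using idx_cyc[of i] by (simp only:)
  then show False using assms by (cases "idx i = CARD('n)") auto
qed

text \<open>One turn around the cycle: \<open>P\<close> climbs from \<open>i\<close> to the maximum,
  wraps to the first index, and climbs from there to any \<open>j\<close>.\<close>

lemma cyc_induct:
  assumes "P i" and step: "\<And>i. P i \<Longrightarrow> P (cyc i)"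
  shows "P (j :: 'n::{finite,linorder})"
proof -
  have up: "P k" if "P i" "i \<le> k" for i k :: 'n
  proof -
    have "\<forall>k :: 'n. idx k = m \<longrightarrow> P k" if "idx i \<le> m" for m
      using that
    proof (induction m rule: dec_induct)
      case base
      then show ?case using \<open>P i\<close> by simp
    next
      case (step m)
      show ?case
      proof (intro allI impI)
        fix k :: 'n assume k: "idx k = Suc m"
        have "m \<in> {1..CARD('n)}" using idx_bounds(2)[of k] idx_bounds(1)[of i] k step by simp
        then obtain k' :: 'n where k': "idx k' = m" unfolding range_idx[symmetric] by blast
        then have "idx (cyc k') = idx k" using k idx_bounds(2)[of k] by (simp add: idx_cyc)
        then show "P k" using assms(2)[of k'] step.IH k' by simp
      qed
    qed
    from this[of "idx k"] \<open>i \<le> k\<close> have "\<forall>k'. idx k' = idx k \<longrightarrow> P k'" by simp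
    then show ?thesis by blast
  qed
  have "P (Max UNIV)" using up[OF \<open>P i\<close>] by simp
  then have "P (cyc (Max UNIV))" by (rule step)
  moreover have "idx (Max (UNIV :: 'n set)) = CARD('n)" by (simp add: idx_def atMost_def)
  then have "idx (cyc (Max (UNIV :: 'n set))) \<le> idx j" using idx_bounds(1)[of j] by (simp add: idx_cyc)
  ultimately show ?thesis using up by simp
qed

section \<open>Determinant of a cyclic bidiagonal matrix\<close>

text \<open>If \<open>p\<close> follows \<open>cyc\<close> at \<open>k\<close>, injectivity forbids
  it to fix \<open>cyc k\<close>, so it follows \<open>cyc\<close> there too, and hence all the way
  around.\<close>

lemma permutes_id_or_cyc:
  assumes n: "CARD('n::{finite,linorder}) \<ge> 2"
    and p: "p permutes (UNIV :: 'n set)" "\<And>i. p i = i \<or> p i = cyc i"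
  shows "p = id \<or> p = cyc"
proof (cases "\<exists>i. p i = cyc i")
  case True
  then obtain i where "p i = cyc i" ..
  have "p j = cyc j" for j
  proof (rule cyc_induct[of "\<lambda>j. p j = cyc j"])
    fix k assume "p k = cyc k"
    then have "p (cyc k) \<noteq> cyc k"
      using permutes_inj[OF p(1)] cyc_neq[OF n, of k] by (metis injD)
    then show "p (cyc k) = cyc (cyc k)" using p(2) by blast
  qed fact
  then show ?thesis by blast
next
  case False
  then show ?thesis using p(2) by (auto simp: fun_eq_iff)
qed

lemma det_cyclic_bidiagonal_sign:
  fixes A :: "real^('n::{finite,linorder})^('n::{finite,linorder})"
  assumes n: "CARD('n) \<ge> 2" and A: "\<And>i j. j \<noteq> i \<Longrightarrow> j \<noteq> cyc i \<Longrightarrow> A $ i $ j = 0"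
  shows "det A = (\<Prod>i\<in>UNIV. A $ i $ i) + of_int (sign (cyc :: 'n \<Rightarrow> 'n)) * (\<Prod>i\<in>UNIV. A $ i $ cyc i)"
proof -
  have perm: "cyc permutes (UNIV :: 'n set)" using bij_cyc by (intro bij_imp_permutes) auto
  have "det A = (\<Sum>p | p permutes (UNIV :: 'n set). of_int (sign p) * (\<Prod>i\<in>UNIV. A $ i $ p i))"
    by (simp add: det_def)
  also have "\<dots> = (\<Sum>p\<in>{id, cyc}. of_int (sign p) * (\<Prod>i\<in>UNIV. A $ i $ p i))"
  proof (rule sum.mono_neutral_right)
    show "{id, cyc} \<subseteq> {p. p permutes (UNIV :: 'n set)}" using perm permutes_id by auto
    show "\<forall>p\<in>{p. p permutes (UNIV :: 'n set)} - {id, cyc}. of_int (sign p) * (\<Prod>i\<in>UNIV. A $ i $ p i) = 0"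
    proof
      fix p assume p: "p \<in> {p. p permutes (UNIV :: 'n set)} - {id, cyc}"
      then obtain i where "p i \<noteq> i" "p i \<noteq> cyc i" using permutes_id_or_cyc[OF n] by blast
      then have "A $ i $ p i = 0" using A by blast
      then show "of_int (sign p) * (\<Prod>i\<in>UNIV. A $ i $ p i) = 0"
        by (metis (mono_tags, lifting) UNIV_I finite mult_zero_right prod_zero)
    qed
  qed simp
  also have "id \<noteq> (cyc :: 'n \<Rightarrow> 'n)" using cyc_neq[OF n] by (metis id_apply)
  then have "(\<Sum>p\<in>{id, cyc}. of_int (sign p) * (\<Prod>i\<in>UNIV. A $ i $ p i))
      = (\<Prod>i\<in>UNIV. A $ i $ i) + of_int (sign (cyc :: 'n \<Rightarrow> 'n)) * (\<Prod>i\<in>UNIV. A $ i $ cyc i)"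
    by (simp add: sign_id)
  finally show ?thesis .
qed

text \<open>The sign is solved from the determinant formula: for a singular matrix with diagonal -1
  and relevant entries 1 it reads \<open>0 = (-1) ^ n + sign cyc\<close>.\<close>

lemma sign_cyc:
  assumes n: "CARD('n::{finite,linorder}) \<ge> 2"
  shows "sign (cyc :: 'n \<Rightarrow> 'n) = (-1) ^ (CARD('n) + 1)"
proof -
  \<comment> \<open>This matrix has zero row sums, hence is singular.\<close>
  define M :: "((real, 'n) vec, 'n) vec" where
    "M = (\<chi> i j. if j = i then -1 else if j = cyc i then 1 else 0)"
  have "(\<Sum>j\<in>UNIV. M $ i $ j) = 0" for i
  proof -
    have "(\<Sum>j\<in>UNIV. M $ i $ j) = (\<Sum>j\<in>{i, cyc i}. M $ i $ j)"
      by (rule sum.mono_neutral_right) (auto simp: M_def)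
    then show ?thesis using cyc_neq[OF n, of i] by (simp add: M_def)
  qed
  then have "M *v 1 = 0" by (simp add: matrix_vector_mult_def vec_eq_iff)
  moreover have "(1 :: (real, 'n) vec) \<noteq> 0" by (simp add: vec_eq_iff)
  ultimately have "\<not> invertible M"
    unfolding invertible_left_inverse matrix_left_invertible_ker by blast
  then have "det M = 0" by (simp add: invertible_det_nz)
  moreover have "det M = (-1) ^ CARD('n) + of_int (sign (cyc :: 'n \<Rightarrow> 'n))"
    using cyc_neq[OF n] by (subst det_cyclic_bidiagonal_sign[OF n]) (auto simp: M_def)
  ultimately have "real_of_int (sign (cyc :: 'n \<Rightarrow> 'n)) = of_int ((-1) ^ (CARD('n) + 1))" by simp
  then show ?thesis by (simp only: of_int_eq_iff)
qed

lemma prod_mult_cyc: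
  fixes c x :: "'n::{finite,linorder} \<Rightarrow> 'a::comm_monoid_mult"
  shows "(\<Prod>i\<in>UNIV. c i * x (cyc i)) = (\<Prod>i\<in>UNIV. c i) * (\<Prod>i\<in>UNIV. x i)"
  by (simp add: prod.distrib prod_cyc)

section \<open>Complementarity problems for Type-III matrices\<close>

lemma min_map_eq_0_iff: "min_map A x = 0 \<longleftrightarrow> x \<in> LCP A 0"
proof
  assume "min_map A x = 0"
  then have "min (x $ i) ((A *v x) $ i) = 0" for i
    by (simp add: min_map_def vec_eq_iff)
  then have *: "x $ i \<ge> 0 \<and> (A *v x) $ i \<ge> 0 \<and> x $ i * (A *v x) $ i = 0" for i
    by (metis min.cobounded1 min.cobounded2 min_def mult_eq_0_iff)
  then show "x \<in> LCP A 0" by (auto simp: LCP_def inner_vec_def intro!: sum.neutral)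
next
  assume x: "x \<in> LCP A 0"
  then have "(\<Sum>i\<in>UNIV. x $ i * (A *v x) $ i) = 0" by (simp add: LCP_def inner_vec_def)
  then have "x $ i = 0 \<or> (A *v x) $ i = 0" for i
    using x by (subst (asm) sum_nonneg_eq_0_iff) (auto simp: LCP_def)
  moreover have "x $ i \<ge> 0" "(A *v x) $ i \<ge> 0" for i using x by (simp_all add: LCP_def)
  ultimately have "min (x $ i) ((A *v x) $ i) = 0" for i by (metis min.absorb1 min.absorb2)
  then show "min_map A x = 0" by (simp add: min_map_def vec_eq_iff)
qed

lemma continuous_on_min_map: "continuous_on S (min_map A)"
  unfolding min_map_def
  by (intro continuous_on_vec_lambda continuous_intros matrix_vector_mult_linear_continuous_on)

lemma LCP_degree_eqI:
  assumes "\<And>\<Omega>. open \<Omega> \<Longrightarrow> bounded \<Omega> \<Longrightarrow> 0 \<in> \<Omega> \<Longrightarrow> topological_degree (min_map A) \<Omega> 0 = d"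
  shows "LCP_degree A = d"
  unfolding LCP_degree_def
proof (rule the_equality)
  fix d' assume "\<forall>\<Omega>. open \<Omega> \<and> bounded \<Omega> \<and> 0 \<in> \<Omega> \<longrightarrow> topological_degree (min_map A) \<Omega> 0 = d'"
  then have "topological_degree (min_map A) (ball 0 1) 0 = d'" by simp
  then show "d' = d" using assms[of "ball 0 1"] by simp
qed (use assms in blast)

section \<open>Sign patterns of Type-III matrices and the two products\<close>

locale type_III =
  fixes A :: "real^('n::{finite,linorder})^('n::{finite,linorder})"
  assumes card_ge_2: "CARD('n) \<ge> 2" and type_III: "bdsw_type_III A"
begin

definition a :: "'n \<Rightarrow> real" where "a i = - A $ i $ i"
definition b :: "'n \<Rightarrow> real" where "b i = A $ i $ cyc i"

lemma a_pos: "a i > 0" and b_pos: "b i > 0"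
  using type_III by (simp_all add: bdsw_type_III_def relevant_offdiag_iff a_def b_def)

lemma prod_a_pos: "prod a UNIV > 0"
  by (simp add: prod_pos a_pos)

lemma entry_eq_0: "j \<noteq> i \<Longrightarrow> j \<noteq> cyc i \<Longrightarrow> A $ i $ j = 0"
  using type_III by (simp add: bdsw_type_III_def bdsw_def relevant_offdiag_iff)

lemma row: "(A *v x) $ i = b i * x $ cyc i - a i * x $ i"
proof -
  have "(A *v x) $ i = (\<Sum>j\<in>UNIV. A $ i $ j * x $ j)" by (simp add: matrix_vector_mult_def)
  also have "\<dots> = (\<Sum>j\<in>{i, cyc i}. A $ i $ j * x $ j)"
    by (rule sum.mono_neutral_right) (auto simp: entry_eq_0)
  finally show ?thesis using cyc_neq[OF card_ge_2, of i] by (simp add: a_def b_def)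
qed

lemma det_eq: "(-1) ^ (CARD('n) + 1) * det A = prod b UNIV - prod a UNIV"
proof -
  let ?s = "(-1) ^ CARD('n) :: real"
  have "prod a UNIV = ?s * (\<Prod>i\<in>UNIV. A $ i $ i)"
    using prod.distrib[of "\<lambda>_. -1" "\<lambda>i. A $ i $ i" UNIV] by (simp add: a_def)
  moreover have "det A = (\<Prod>i\<in>UNIV. A $ i $ i) - ?s * prod b UNIV"
    using det_cyclic_bidiagonal_sign[OF card_ge_2, of A] entry_eq_0
    by (simp add: b_def sign_cyc[OF card_ge_2])
  moreover have "- ?s * (p - ?s * q) = q - ?s * p" for p q
    by (simp add: right_diff_distrib flip: mult.assoc power_mult_distrib)
  ultimately show ?thesis by simp
qed

text \<open>Each row gives \<open>a i * x $ i < b i * x $ cyc i\<close>; multiplied around the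
  cycle, the entries of \<open>x\<close> cancel.\<close>

lemma prod_less:
  assumes x: "\<And>i. x $ i > 0" and Ax: "\<And>i. (A *v x) $ i > 0"
  shows "prod a UNIV < prod b UNIV"
proof -
  have "prod a UNIV * (\<Prod>i\<in>UNIV. x $ i) = (\<Prod>i\<in>UNIV. a i * x $ i)"
    by (simp add: prod.distrib)
  also have "\<dots> < (\<Prod>i\<in>UNIV. b i * x $ cyc i)"
  proof (rule prod_mono_strict)
    show "0 \<le> a i * x $ i \<and> a i * x $ i \<le> b i * x $ cyc i" for i
      using x[of i] Ax[of i] a_pos[of i] by (simp add: row)
    \<comment> \<open>Strictness is wanted at one arbitrary index; \<open>undefined\<close> names
      one.\<close>
    show "a undefined * x $ undefined < b undefined * x $ cyc undefined"
      using Ax[of undefined] by (simp add: row)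
    show "0 < b i * x $ cyc i" for i using x b_pos by simp
  qed auto
  also have "\<dots> = prod b UNIV * (\<Prod>i\<in>UNIV. x $ i)"
    by (rule prod_mult_cyc)
  finally show ?thesis
    using x by (simp add: prod_pos)
qed

text \<open>For negative \<open>x\<close> the rows bound \<open>b i * - x $ cyc i\<close> by
  \<open>a i * - x $ i\<close>, which reverses the comparison of the products.\<close>

lemma prod_le:
  assumes x: "\<And>i. x $ i < 0" and Ax: "\<And>i. (A *v x) $ i \<ge> 0"
  shows "prod b UNIV \<le> prod a UNIV"
proof -
  have "prod b UNIV * (\<Prod>i\<in>UNIV. - x $ i) = (\<Prod>i\<in>UNIV. b i * - x $ cyc i)"
    by (rule prod_mult_cyc[symmetric])
  also have "\<dots> \<le> (\<Prod>i\<in>UNIV. a i * - x $ i)"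
  proof (rule prod_mono)
    show "0 \<le> b i * - x $ cyc i \<and> b i * - x $ cyc i \<le> a i * - x $ i" for i
      using x[of "cyc i"] Ax[of i] b_pos[of i] by (simp add: row mult_nonneg_nonpos)
  qed
  also have "\<dots> = prod a UNIV * (\<Prod>i\<in>UNIV. - x $ i)"
    by (simp only: prod.distrib)
  finally show ?thesis
    using x by (simp add: prod_pos)
qed

lemma prod_eq:
  assumes x: "\<And>i. x $ i > 0" and Ax: "A *v x = 0"
  shows "prod a UNIV = prod b UNIV"
proof -
  have "a i * x $ i = b i * x $ cyc i" for i using row[of x i] Ax by simp
  then have "prod a UNIV * (\<Prod>i\<in>UNIV. x $ i) = (\<Prod>i\<in>UNIV. b i * x $ cyc i)"
    by (simp flip: prod.distrib)
  also have "\<dots> = prod b UNIV * (\<Prod>i\<in>UNIV. x $ i)" by (rule prod_mult_cyc)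
  finally have "prod a UNIV * (\<Prod>i\<in>UNIV. x $ i) = prod b UNIV * (\<Prod>i\<in>UNIV. x $ i)" .
  moreover have "(\<Prod>i\<in>UNIV. x $ i) > 0" using x by (simp add: prod_pos)
  ultimately show ?thesis by (metis less_irrefl mult_cancel_right)
qed

text \<open>Row \<open>k\<close> says \<open>a k * x $ k \<le> b k * x $ cyc k\<close>, so the sign
  passes from each entry to its successor.\<close>

lemma nonneg_propagates:
  assumes "\<And>i. (A *v x) $ i \<ge> 0" "x $ i \<ge> 0"
  shows "x $ j \<ge> 0"
proof (rule cyc_induct[of "\<lambda>j. x $ j \<ge> 0"])
  fix k assume "x $ k \<ge> 0"
  then have "0 \<le> a k * x $ k" using a_pos[of k] by simp
  also have "\<dots> \<le> b k * x $ cyc k" using assms(1)[of k] by (simp add: row)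
  finally show "x $ cyc k \<ge> 0" using b_pos[of k] by (simp add: zero_le_mult_iff)
qed fact

lemma pos_propagates:
  assumes "\<And>i. (A *v x) $ i \<ge> 0" "x $ i > 0"
  shows "x $ j > 0"
proof (rule cyc_induct[of "\<lambda>j. x $ j > 0"])
  fix k assume "x $ k > 0"
  then have "0 < a k * x $ k" using a_pos[of k] by simp
  also have "\<dots> \<le> b k * x $ cyc k" using assms(1)[of k] by (simp add: row)
  finally show "x $ cyc k > 0" using b_pos[of k] by (simp add: zero_less_mult_iff)
qed fact

text \<open>One nonnegative entry makes all of them nonnegative; if all are negative,
  \<open>prod_le\<close> contradicts the assumption on the products.\<close>

lemma inverse_nonneg:
  assumes "prod a UNIV < prod b UNIV" "\<And>i. (A *v x) $ i \<ge> 0"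
  shows "x $ j \<ge> 0"
  using prod_le[of x] nonneg_propagates[of x] assms by (meson not_le)

section \<open>Columns of the inverse\<close>

text \<open>Growth factor of one full turn around the cycle, above 1 exactly when
  \<open>prod a UNIV < prod b UNIV\<close>.\<close>

definition g :: real where "g = prod b UNIV / prod a UNIV"
text \<open>Closed form of the backward recursion from the last row that makes every other row of
  \<open>A\<close> vanish.\<close>

definition \<rho> :: "'n \<Rightarrow> real" where "\<rho> i = (\<Prod>k\<in>{i..}. b k / a k)"

lemma \<rho>_pos: "\<rho> i > 0"
  by (simp add: \<rho>_def prod_pos a_pos b_pos)

lemma \<rho>_last:
  assumes "idx i = CARD('n)"
  shows "a i * \<rho> i = b i" "\<rho> (cyc i) = g"
proof -
  have "j \<le> i" for j using assms idx_bounds(2)[of j] by (metis idx_le_iff)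
  then have "{i..} = {i}" by (auto intro: antisym)
  then show "a i * \<rho> i = b i" using a_pos[of i] by (simp add: \<rho>_def)
  have "idx (cyc i) = 1" using assms by (simp add: idx_cyc)
  then have "cyc i \<le> j" for j using idx_bounds(1)[of j] by (metis idx_le_iff)
  then have "{cyc i..} = UNIV" by auto
  then show "\<rho> (cyc i) = g" by (simp add: \<rho>_def g_def prod_dividef)
qed

lemma \<rho>_step:
  assumes "idx i \<noteq> CARD('n)"
  shows "b i * \<rho> (cyc i) = a i * \<rho> i"
proof -
  have "cyc i \<le> j \<longleftrightarrow> i < j" for j
    using idx_cyc[of i] assms idx_le_iff[of "cyc i" j] idx_less_iff[of i j]
    by (simp add: Suc_le_eq del: idx_le_iff idx_less_iff)
  then have "{cyc i..} = {i<..}" by (simp only: atLeast_def greaterThan_def)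
  moreover have "{i..} = insert i {i<..}" by auto
  ultimately show ?thesis using a_pos[of i] by (simp add: \<rho>_def)
qed

text \<open>Scaling the entries beyond \<open>m\<close> by \<open>g\<close> balances the last row
  against the value \<open>g\<close> at the first index and leaves a defect only in row
  \<open>m\<close>.\<close>

definition w :: "'n \<Rightarrow> (real, 'n) vec" where "w m = (\<chi> i. if i \<le> m then \<rho> i else g * \<rho> i)"

text \<open>By the next lemma, \<open>w m\<close> is a multiple of the \<open>m\<close>-th column of the inverse of \<open>A\<close>.\<close>

lemma mult_w: "(A *v w m) $ i = (if i = m then (g - 1) * (a i * \<rho> i) else 0)"
proof (cases "idx i = CARD('n)")
  case True
  have "cyc i \<le> m" using True idx_bounds(1)[of m] idx_cyc[of i] by (metis idx_le_iff)
  moreover have "i \<le> m \<longleftrightarrow> i = m" using True idx_bounds(2)[of m] by (metis idx_le_iff order.antisym order.refl)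
  ultimately have "w m $ cyc i = g" "a i * w m $ i = (if i = m then b i else g * b i)"
    using \<rho>_last[OF True] by (auto simp: w_def mult.left_commute[of _ g])
  then have "(A *v w m) $ i = b i * g - (if i = m then b i else g * b i)" by (simp only: row)
  then show ?thesis by (simp only: \<rho>_last(1)[OF True]) (simp add: algebra_simps)
next
  case False
  \<comment> \<open>Off the last row, \<open>i\<close> and \<open>cyc i\<close> lie on the same side
    of \<open>m\<close> unless \<open>i = m\<close>.\<close>
  have "cyc i \<le> m \<longleftrightarrow> i < m"
    using idx_cyc[of i] False idx_le_iff[of "cyc i" m] idx_less_iff[of i m]
    by (simp add: Suc_le_eq del: idx_le_iff idx_less_iff)
  moreover have "b i * (g * \<rho> (cyc i)) = g * (a i * \<rho> i)"
    unfolding \<rho>_step[OF False, symmetric] by (rule mult.left_commute)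
  ultimately show ?thesis using \<rho>_step[OF False] by (auto simp: row w_def algebra_simps)
qed

section \<open>Solvability for every \<open>q\<close>\<close>

lemma Q_matrix_if_prod_less:
  assumes "prod a UNIV < prod b UNIV"
  shows "Q_matrix A"
  unfolding Q_matrix_def
proof
  fix q
  have g: "g > 1" using assms prod_a_pos by (simp add: g_def)
  have "invertible A" using det_eq assms by (auto simp: invertible_det_nz)
  then obtain B where "A ** B = mat 1" by (auto simp: invertible_def)
  then have "A *v (B *v (- q)) = - q" by (simp only: matrix_vector_mul_assoc matrix_vector_mul_lid)
  then obtain x where x: "A *v x = - q" by blast
  show "LCP A q \<noteq> {}"
  proof (cases "\<forall>i. x $ i \<ge> 0")
    case True
    then have "x \<in> LCP A q" using x by (simp add: LCP_def)
    then show ?thesis by blast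
  next
    case False
    then obtain k where k: "x $ k < 0" by (auto simp: not_le)
    let ?r = "\<lambda>j. x $ j / \<rho> j"
    \<comment> \<open>When multiples of \<open>\<rho>\<close> are added to \<open>x\<close>, entry
      \<open>m\<close> is the last to become nonnegative; \<open>\<mu>\<close> is the multiple at
      which it is exactly 0.\<close>
    obtain m where m: "\<And>j. ?r m \<le> ?r j"
    proof -
      have "Min (range ?r) \<in> range ?r" by (intro Min_in) auto
      then obtain m where "Min (range ?r) = ?r m" by (rule imageE)
      moreover have "Min (range ?r) \<le> ?r j" for j by (rule Min_le) auto
      ultimately show thesis using that[of m] by presburger
    qed
    define \<mu> where "\<mu> = - ?r m"
    have "?r k < 0" using k \<rho>_pos[of k] by (simp add: divide_less_0_iff)
    then have \<mu>: "\<mu> > 0" using m[of k] by (simp add: \<mu>_def)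
    define z where "z = x + \<mu> *\<^sub>R w m"
    have zm: "z $ m = 0" using \<rho>_pos[of m] by (simp add: z_def \<mu>_def w_def)
    have z: "z $ j \<ge> 0" for j
    proof -
      \<comment> \<open>Because \<open>g > 1\<close>, using \<open>w m\<close> in place of
        \<open>\<rho>\<close> can only enlarge the entries.\<close>
      have w: "w m $ j \<ge> \<rho> j" using g \<rho>_pos[of j] by (simp add: w_def)
      moreover have "x $ j \<ge> - \<mu> * \<rho> j" using m[of j] \<rho>_pos[of j] by (simp add: \<mu>_def field_simps)
      moreover from w have "\<mu> * \<rho> j \<le> \<mu> * w m $ j" using \<mu> by (intro mult_left_mono) auto
      ultimately show ?thesis by (simp add: z_def)
    qed
    have Az: "(A *v z + q) $ i = (if i = m then \<mu> * ((g - 1) * (a i * \<rho> i)) else 0)" for i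
      by (simp add: z_def matrix_vector_right_distrib matrix_vector_mult_scaleR x mult_w)
    \<comment> \<open>The only nonzero slack is in row \<open>m\<close>, where \<open>z\<close>
      vanishes.\<close>
    have "z $ i * (A *v z + q) $ i = 0" for i unfolding Az by (simp add: zm)
    then have "z \<bullet> (A *v z + q) = 0"
      unfolding inner_vec_def inner_real_def by (simp only: sum.neutral_const)
    moreover have "(A *v z + q) $ i \<ge> 0" for i
      unfolding Az using \<mu> g a_pos \<rho>_pos by (simp add: less_imp_le)
    ultimately have "z \<in> LCP A q" using z by (simp add: LCP_def)
    then show ?thesis by blast
  qed
qed

lemma prod_less_if_Q_matrix:
  assumes "Q_matrix A"
  shows "prod a UNIV < prod b UNIV"
proof -
  obtain x where "x \<in> LCP A (- 1)" using assms by (auto simp: Q_matrix_def)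
  then have x: "x $ i \<ge> 0" and Ax: "(A *v x) $ i \<ge> 1" for i by (auto simp: LCP_def)
  have "x $ i > 0" for i
  proof -
    \<comment> \<open>Each row makes its successor entry positive; cyclic induction started at a
      successor then reaches every index.\<close>
    have pos: "x $ cyc j > 0" for j
    proof -
      have "0 \<le> a j * x $ j" using a_pos[of j] x[of j] by simp
      also have "\<dots> < b j * x $ cyc j" using Ax[of j] by (simp add: row)
      finally show ?thesis using b_pos[of j] by (simp add: zero_less_mult_iff)
    qed
    show "x $ i > 0"
      by (rule cyc_induct[of "\<lambda>i. x $ i > 0", OF pos pos])
  qed
  moreover have "(A *v x) $ i > 0" for i using Ax[of i] by linarith
  ultimately show ?thesis by (rule prod_less)
qed

text \<open>Equal products give \<open>g = 1\<close>, so \<open>w m\<close> is a positive kernel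
  vector. Conversely, a nonzero solution is positive everywhere, so complementarity puts it in the
  kernel, and \<open>prod_eq\<close> makes the products equal.\<close>

lemma R0_matrix_iff: "R0_matrix A \<longleftrightarrow> prod a UNIV \<noteq> prod b UNIV"
proof
  assume R0: "R0_matrix A"
  show "prod a UNIV \<noteq> prod b UNIV"
  proof
    assume "prod a UNIV = prod b UNIV"
    then have g: "g = 1" using prod_a_pos by (metis divide_self g_def less_irrefl)
    fix m :: 'n
    have "A *v w m = 0" by (simp add: vec_eq_iff mult_w g)
    moreover have pos: "w m $ i > 0" for i using \<rho>_pos[of i] by (simp add: w_def g)
    ultimately have "w m \<in> LCP A 0" by (simp add: LCP_def less_imp_le)
    then have "w m = 0" using R0 by (simp add: R0_matrix_def)
    then show False using pos[of m] by simp
  qed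
next
  assume ne: "prod a UNIV \<noteq> prod b UNIV"
  have "x = 0" if "x \<in> LCP A 0" for x
  proof (rule ccontr)
    assume "x \<noteq> 0"
    have x: "x $ i \<ge> 0" "(A *v x) $ i \<ge> 0" for i using that by (auto simp: LCP_def)
    obtain i where "x $ i \<noteq> 0" using \<open>x \<noteq> 0\<close> by (auto simp: vec_eq_iff)
    then have "x $ i > 0" using x(1)[of i] by simp
    then have pos: "x $ j > 0" for j using pos_propagates x(2) by blast
    have "min_map A x = 0" using that by (simp add: min_map_eq_0_iff)
    then have "min (x $ j) ((A *v x) $ j) = 0" for j by (simp add: min_map_def vec_eq_iff)
    then have "(A *v x) $ j = 0" for j using pos[of j] by (metis min_def less_irrefl)
    then have "A *v x = 0" by (simp add: vec_eq_iff)
    then show False using prod_eq[OF pos] ne by blast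
  qed
  moreover have "0 \<in> LCP A 0" by (simp add: LCP_def)
  ultimately show "R0_matrix A" by (auto simp: R0_matrix_def)
qed

section \<open>Degree of the min map\<close>

lemma min_map_eq_0_iff_eq_0:
  assumes "prod a UNIV \<noteq> prod b UNIV"
  shows "min_map A x = 0 \<longleftrightarrow> x = 0"
  using assms R0_matrix_iff by (simp add: min_map_eq_0_iff R0_matrix_def)

text \<open>As \<open>min_map A x\<close> is at most \<open>A *v x\<close>, a vanishing combination
  forces \<open>A *v x \<ge> 0\<close>, hence \<open>x \<ge> 0\<close>. Both summands are then
  nonnegative and vanish separately.\<close>

lemma min_map_homotopy_nonzero:
  assumes less: "prod a UNIV < prod b UNIV" and "x \<noteq> 0" and t: "0 \<le> t" "t \<le> 1"
  shows "(1 - t) *\<^sub>R min_map A x + t *\<^sub>R (A *v x) \<noteq> 0"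
proof
  assume "(1 - t) *\<^sub>R min_map A x + t *\<^sub>R (A *v x) = 0"
  then have eq: "(1 - t) * min (x $ i) ((A *v x) $ i) + t * (A *v x) $ i = 0" for i
    by (simp add: vec_eq_iff min_map_def)
  have Ax: "(A *v x) $ i \<ge> 0" for i
  proof (rule ccontr)
    assume neg: "\<not> (A *v x) $ i \<ge> 0"
    have "(1 - t) * min (x $ i) ((A *v x) $ i) \<le> (1 - t) * (A *v x) $ i"
      using t by (intro mult_left_mono) auto
    then have "0 \<le> (A *v x) $ i" using eq[of i] by (simp add: algebra_simps)
    then show False using neg by simp
  qed
  have x: "x $ i \<ge> 0" for i by (rule inverse_nonneg[OF less Ax])
  show False
  proof (cases "t = 0")
    case True
    then have "min_map A x = 0" using eq by (simp add: min_map_def vec_eq_iff)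
    then show False using less \<open>x \<noteq> 0\<close> by (simp add: min_map_eq_0_iff_eq_0)
  next
    case False
    have "(A *v x) $ i = 0" for i
    proof -
      have "0 \<le> (1 - t) * min (x $ i) ((A *v x) $ i)" using t x Ax by simp
      moreover have "0 \<le> t * (A *v x) $ i" using t Ax by simp
      ultimately have "t * (A *v x) $ i = 0" using eq[of i] by linarith
      then show ?thesis using False by simp
    qed
    then have "min_map A x = 0" using x by (simp add: min_map_def vec_eq_iff)
    then show False using less \<open>x \<noteq> 0\<close> by (simp add: min_map_eq_0_iff_eq_0)
  qed
qed

lemma LCP_degree_if_prod_less:
  assumes less: "prod a UNIV < prod b UNIV"
  shows "LCP_degree A = 1 \<or> LCP_degree A = -1"
proof -
  have lin: "linear ((*v) A)" by (rule matrix_vector_mul_linear)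
  have "A *v x \<noteq> 0" if "x \<noteq> 0" for x
    using min_map_homotopy_nonzero[OF less that, of 1] by simp
  then have inj: "inj ((*v) A)" using lin by (auto simp: linear_injective_0)
  obtain e :: int where e: "e = 1 \<or> e = -1" and
    pow: "\<And>x. x \<in> carrier (relative_homology_group (int DIM((real, 'n) vec)) (euclidean :: (real, 'n) vec topology) (- {0})) \<Longrightarrow>
      hom_induced (int DIM((real, 'n) vec)) euclidean (- {0}) euclidean (- {0}) ((*v) A) x
      = x [^]\<^bsub>relative_homology_group (int DIM((real, 'n) vec)) (euclidean :: (real, 'n) vec topology) (- {0})\<^esub> e"
    by (rule hom_induced_linear_iso_power[OF lin inj]) (rule that)
  have zero: "min_map A 0 = 0" using less by (simp add: min_map_eq_0_iff_eq_0)
  have "LCP_degree A = e"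
  proof (rule LCP_degree_eqI)
    fix \<Omega> :: "(real, 'n) vec set" assume "open \<Omega>" "bounded \<Omega>" "0 \<in> \<Omega>"
    then show "topological_degree (min_map A) \<Omega> 0 = e"
      by (rule topological_degree_homotopic_linear_iso[OF _ _ _ continuous_on_min_map zero lin
            min_map_homotopy_nonzero[OF less] pow])
  qed
  then show ?thesis using e by blast
qed

text \<open>In this case \<open>min_map A\<close> omits all positive vectors, hence it is homotopic to a map without zeros.\<close>

lemma LCP_degree_if_prod_greater:
  assumes "prod b UNIV < prod a UNIV"
  shows "LCP_degree A = 0"
proof (rule LCP_degree_eqI)
  fix \<Omega> :: "(real, 'n) vec set" assume "open \<Omega>" "bounded \<Omega>" "0 \<in> \<Omega>"
  then show "topological_degree (min_map A) \<Omega> 0 = 0"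
  proof (rule topological_degree_eq_0)
    show "min_map A x = 0 \<longleftrightarrow> x = 0" for x using assms by (simp add: min_map_eq_0_iff_eq_0)
    \<comment> \<open>A preimage of a positive multiple of the all-ones vector would be positive
      with positive image, as in \<open>prod_less\<close>.\<close>
    show "min_map A x \<noteq> t *\<^sub>R 1" if t: "t > 0" for x t
    proof
      assume "min_map A x = t *\<^sub>R 1"
      then have eq: "min (x $ i) ((A *v x) $ i) = t" for i by (simp add: min_map_def vec_eq_iff)
      have "prod a UNIV < prod b UNIV"
      proof (rule prod_less)
        show "x $ i > 0" for i using t eq[of i] by linarith
        show "(A *v x) $ i > 0" for i using t eq[of i] by linarith
      qed
      then show False using assms by simp
    qed
  qed (rule continuous_on_min_map)
qed

end

theorem theorem7p1:
  fixes A :: "real^('n::{finite,linorder})^('n::{finite,linorder})"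
  assumes "CARD('n) \<ge> 2"
    and "bdsw_type_III A"
  shows "(Q_matrix A \<longleftrightarrow> (-1) ^ (CARD('n) + 1) * det A > 0) \<and>
         ((-1) ^ (CARD('n) + 1) * det A > 0 \<longleftrightarrow>
            R0_matrix A \<and> (LCP_degree A = 1 \<or> LCP_degree A = -1))"
proof -
  interpret type_III A using assms by unfold_locales
  have "(-1) ^ (CARD('n) + 1) * det A > 0 \<longleftrightarrow> prod a UNIV < prod b UNIV"
    unfolding det_eq by simp
  moreover have "Q_matrix A \<longleftrightarrow> prod a UNIV < prod b UNIV"
    using Q_matrix_if_prod_less prod_less_if_Q_matrix by blast
  \<comment> \<open>Equal products are excluded by \<open>R0_matrix A\<close>, the reversed
    inequality by degree 0.\<close>
  moreover have "R0_matrix A \<and> (LCP_degree A = 1 \<or> LCP_degree A = -1) \<longleftrightarrow> prod a UNIV < prod b UNIV"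
    using R0_matrix_iff LCP_degree_if_prod_less LCP_degree_if_prod_greater
    by (metis less_irrefl linorder_less_linear zero_neq_one zero_neq_neg_one)
  ultimately show ?thesis by blast
qed

end
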